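(* Under the multiplier assumptions (A1) on the prior uncertainty set $\boldsymbol{\Delta}_{\rm prior}$ and (A2) on the disturbance set $\boldsymbol{D}$ given in the context, and with the sets $\tilde{\boldsymbol{\Delta}}_{\rm com}$ and $\boldsymbol{\Delta}_{\rm com}$ defined there, it holds that $$\tilde{\boldsymbol{\Delta}}_{\rm com}=B_w\boldsymbol{\Delta}_{\rm com},\qquad\text{where } B_w\boldsymbol{\Delta}_{\rm com}=\{B_w\Delta\mid\Delta\in\boldsymbol{\Delta}_{\rm com}\}.$$
   Context: All matrices are real; $\succeq,\prec$ refer to (semi)definiteness of symmetric matrices. The underlying system is $x_{k+1}=Ax_k+Bu_k+B_dd_k+B_ww_k$, $z_k=C_zx_k+D_zu_k$, $w_k=\Delta z_k$ with $x_k\in\mathbb{R}^n$, $u_k\in\mathbb{R}^m$, $d_k\in\mathbb{R}^{n_d}$, $w_k\in\mathbb{R}^{n_w}$, $z_k\in\mathbb{R}^{n_z}$ and given matrices $A,B,B_d,B_w,C_z,D_z$; $B_d$ has full column rank. A convex cone of symmetric matrices "admits an LMI representation" if it is the projection of the solution set of a strictly feasible linear matrix inequality. (A1) Uncertainties are block diagonal, $\Delta=\mathrm{diag}_{j=1}^{\ell}(\Delta_j)=\sum_{j=1}^{\ell}R_j\Delta_jL_j^\top$ with $\Delta_j\in\mathbb{R}^{n_{w,j}\times n_{z,j}}$, $\sum_j n_{w,j}=n_w$, $\sum_j n_{z,j}=n_z$, where $L_j$ and $R_j$ are the corresponding block columns of $I_{n_z}$ and $I_{n_w}$. Put $B_j=B_wR_j$,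 so $B_w=[B_1\ \cdots\ B_\ell]$; each $B_j$ has full column rank. The prior set is $\boldsymbol{\Delta}_{\rm prior}=\{\mathrm{diag}_{j=1}^\ell(\Delta_j)\mid\Delta_j\in\boldsymbol{\Delta}_j\}$ with $$\boldsymbol{\Delta}_j=\Big\{\Delta_j\in\mathbb{R}^{n_{w,j}\times n_{z,j}}\ \Big|\ \begin{bmatrix} \Delta_j^\top \\ I \end{bmatrix}^\top P_j\begin{bmatrix} \Delta_j^\top \\ I \end{bmatrix}\succeq0\ \ \forall P_j\in\boldsymbol{P}_j\Big\},$$ where $\boldsymbol{P}_j$ is a convex cone of symmetric matrices of size $n_{z,j}+n_{w,j}$ admitting an LMI representation, and for each $j$ some $P_j\in\boldsymbol{P}_j$ has negative definite left-upper $n_{z,j}\times n_{z,j}$ block. (A2) $$\boldsymbol{D}=\Big\{D\in\mathbb{R}^{n_d\times N}\ \Big|\ \begin{bmatrix} D^\top \\ I \end{bmatrix}^\top P_d\begin{bmatrix} D^\top \\ I \end{bmatrix}\succeq0\ \ \forall P_d\in\boldsymbol{P}_d\Big\},$$ where $\boldsymbol{P}_d$ is a convex cone of symmetric matrices of size $N+n_d$ admitting an LMI representation, and some $P_d\in\boldsymbol{P}_d$ has negative definite left-upper $N\times N$ block. Data. A trajectory $\{x_k\}_{k=0}^N$, $\{u_k\}_{k=0}^{N-1}$ of the system is given, generated with some (unknown) $\Delta_{\rm tr}\in\boldsymbol{\Delta}_{\rm prior}$ and some (unknown) disturbance matrix $D_{\rm tr}=[\hat d_0\ \cdots\ \hat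 d_{N-1}]\in\boldsymbol{D}$. Set $X=[x_0\ \cdots\ x_{N-1}]$, $X_+=[x_1\ \cdots\ x_N]$, $U=[u_0\ \cdots\ u_{N-1}]$, $M=X_+-AX-BU$, $Z=C_zX+D_zU$. Sets. $\boldsymbol{\Delta}_{\rm learnt}=\{\Delta\in\mathbb{R}^{n_w\times n_z}\mid M=B_w\Delta Z+B_dD\text{ for some }D\in\boldsymbol{D}\}$ and $\boldsymbol{\Delta}_{\rm com}=\boldsymbol{\Delta}_{\rm prior}\cap\boldsymbol{\Delta}_{\rm learnt}$. Transformed multipliers (images and sums of sets taken elementwise / in the Minkowski sense): $$\tilde{\boldsymbol{P}}=\sum_{j=1}^{\ell}\begin{bmatrix} L_j^\top & 0 \\ 0 & B_j^\top \end{bmatrix}^\top\boldsymbol{P}_j\begin{bmatrix} L_j^\top & 0 \\ 0 & B_j^\top \end{bmatrix},\qquad \tilde{\boldsymbol{P}}_0=\begin{bmatrix} -Z^\top & M^\top \\ 0 & B_d^\top \end{bmatrix}^\top\boldsymbol{P}_d\begin{bmatrix} -Z^\top & M^\top \\ 0 & B_d^\top \end{bmatrix}.$$ Transformed sets: $$\tilde{\boldsymbol{\Delta}}_{\rm prior}=\Big\{\tilde\Delta\in\mathbb{R}^{n\times n_z}\ \Big|\ \begin{bmatrix} \tilde\Delta^\top \\ I \end{bmatrix}^\top\tilde P\begin{bmatrix} \tilde\Delta^\top \\ I \end{bmatrix}\succeq0\ \forall\tilde P\in\tilde{\boldsymbol{P}}\Big\},\quad \tilde{\boldsymbol{\Delta}}_{\rm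 learnt}=\Big\{\tilde\Delta\in\mathbb{R}^{n\times n_z}\ \Big|\ \begin{bmatrix} \tilde\Delta^\top \\ I \end{bmatrix}^\top\tilde P_0\begin{bmatrix} \tilde\Delta^\top \\ I \end{bmatrix}\succeq0\ \forall\tilde P_0\in\tilde{\boldsymbol{P}}_0\Big\},$$ and $\tilde{\boldsymbol{\Delta}}_{\rm com}=\tilde{\boldsymbol{\Delta}}_{\rm prior}\cap\tilde{\boldsymbol{\Delta}}_{\rm learnt}$. *)

theory Defs
  imports "Jordan_Normal_Form.DL_Rank"
begin

definition sym_mats :: "nat \<Rightarrow> real mat set" where
  "sym_mats k = {S \<in> carrier_mat k k. S\<^sup>T = S}"

definition psd :: "real mat \<Rightarrow> bool" where
  "psd S \<longleftrightarrow> S \<in> sym_mats (dim_row S) \<and>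
     (\<forall>v \<in> carrier_vec (dim_row S). 0 \<le> v \<bullet> (S *\<^sub>v v))"

definition pos_def :: "real mat \<Rightarrow> bool" where
  "pos_def S \<longleftrightarrow> S \<in> sym_mats (dim_row S) \<and>
     (\<forall>v \<in> carrier_vec (dim_row S). v \<noteq> 0\<^sub>v (dim_row S) \<longrightarrow> 0 < v \<bullet> (S *\<^sub>v v))"

definition neg_def :: "real mat \<Rightarrow> bool" where
  "neg_def S \<longleftrightarrow> pos_def (- S)"

definition left_upper :: "nat \<Rightarrow> real mat \<Rightarrow> real mat" where
  "left_upper q S = mat q q (\<lambda>ij. S $$ ij)"

definition full_col_rank :: "real mat \<Rightarrow> bool" where
  "full_col_rank S \<longleftrightarrow> vec_space.rank (dim_row S) S = dim_col S"

(* The type of matrices of all sizes is not a commutative monoid, so sums of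
   k x k matrices are taken entrywise. *)
definition mat_sum :: "nat \<Rightarrow> nat \<Rightarrow> (nat \<Rightarrow> real mat) \<Rightarrow> real mat" where
  "mat_sum k p F = mat k k (\<lambda>ij. \<Sum>i<p. F i $$ ij)"

(* For the same reason convex and cone from HOL-Analysis do not apply.
   Only positive scalings are required, so a cone need not contain 0. *)
definition convex_cone_of_sym :: "nat \<Rightarrow> real mat set \<Rightarrow> bool" where
  "convex_cone_of_sym k C \<longleftrightarrow> C \<subseteq> sym_mats k \<and>
     (\<forall>P\<in>C. \<forall>Q\<in>C. \<forall>s\<ge>0. \<forall>t\<ge>0. s + t = 1 \<longrightarrow> s \<cdot>\<^sub>m P + t \<cdot>\<^sub>m Q \<in> C) \<and>
     (\<forall>P\<in>C. \<forall>c>0. c \<cdot>\<^sub>m P \<in> C)"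

(* The affine matrix-valued map y |-> F 0 + y_0 F 1 + ... + y_(p-1) F p
   into r x r matrices. *)
definition affine_mat :: "nat \<Rightarrow> nat \<Rightarrow> (nat \<Rightarrow> real mat) \<Rightarrow> (nat \<Rightarrow> real) \<Rightarrow> real mat" where
  "affine_mat r p F y = F 0 + mat_sum r p (\<lambda>i. y i \<cdot>\<^sub>m F (Suc i))"

(* A projection of the solution set is understood as its image under a linear map
   y |-> y_0 G 0 + ... + y_(p-1) G (p-1).  This covers the
   projection of the solutions (P, y) of an LMI onto P, also if P is restricted to
   a proper subspace of the symmetric matrices (as for multipliers diag (-t I) (t I)
   with t >= 0). *)
definition lmi_representation :: "nat \<Rightarrow> real mat set \<Rightarrow> bool" where
  "lmi_representation k C \<longleftrightarrow>
     (\<exists>p r F G. (\<forall>i\<le>p. F i \<in> sym_mats r) \<and> (\<forall>i<p. G i \<in> sym_mats k) \<and>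
        (\<exists>y. pos_def (affine_mat r p F y)) \<and>
        C = {mat_sum k p (\<lambda>i. y i \<cdot>\<^sub>m G i) | y. psd (affine_mat r p F y)})"

definition quad_set :: "nat \<Rightarrow> nat \<Rightarrow> real mat set \<Rightarrow> real mat set" where
  "quad_set p q C = {\<Delta> \<in> carrier_mat p q.
     \<forall>P\<in>C. psd ((\<Delta>\<^sup>T @\<^sub>r 1\<^sub>m p)\<^sup>T * P * (\<Delta>\<^sup>T @\<^sub>r 1\<^sub>m p))}"

(* Block column j of the K x K identity whose columns are partitioned
   into blocks of widths ks 0, ks 1, ... *)
definition id_block_col :: "nat \<Rightarrow> (nat \<Rightarrow> nat) \<Rightarrow> nat \<Rightarrow> real mat" where
  "id_block_col K ks j = mat K (ks j) (\<lambda>(r, c). 1\<^sub>m K $$ (r, (\<Sum>i<j. ks i) + c))"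

definition \<Delta>_prior ::
  "nat \<Rightarrow> (nat \<Rightarrow> nat) \<Rightarrow> (nat \<Rightarrow> nat) \<Rightarrow> (nat \<Rightarrow> real mat set) \<Rightarrow> real mat set" where
  "\<Delta>_prior l nws nzs Ps =
     {diag_block_mat (map \<Delta>s [0..<l]) | \<Delta>s. \<forall>j<l. \<Delta>s j \<in> quad_set (nws j) (nzs j) (Ps j)}"

definition \<Delta>_learnt ::
  "real mat \<Rightarrow> real mat \<Rightarrow> real mat \<Rightarrow> real mat \<Rightarrow> real mat set \<Rightarrow> real mat set" where
  "\<Delta>_learnt M Z Bw Bd Ds =
     {\<Delta> \<in> carrier_mat (dim_col Bw) (dim_row Z). \<exists>D\<in>Ds. M = Bw * \<Delta> * Z + Bd * D}"

definition prior_outer ::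
  "real mat \<Rightarrow> nat \<Rightarrow> (nat \<Rightarrow> nat) \<Rightarrow> (nat \<Rightarrow> nat) \<Rightarrow> nat \<Rightarrow> real mat" where
  "prior_outer Bw nz nws nzs j =
     (let L = id_block_col nz nzs j; Bj = Bw * id_block_col (dim_col Bw) nws j
      in four_block_mat L\<^sup>T (0\<^sub>m (nzs j) (dim_row Bw)) (0\<^sub>m (nws j) nz) Bj\<^sup>T)"

definition P_tilde ::
  "real mat \<Rightarrow> nat \<Rightarrow> nat \<Rightarrow> (nat \<Rightarrow> nat) \<Rightarrow> (nat \<Rightarrow> nat) \<Rightarrow> (nat \<Rightarrow> real mat set) \<Rightarrow> real mat set" where
  "P_tilde Bw nz l nws nzs Ps =
     {mat_sum (nz + dim_row Bw) l
        (\<lambda>j. (prior_outer Bw nz nws nzs j)\<^sup>T * P j * prior_outer Bw nz nws nzs j)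
      | P. \<forall>j<l. P j \<in> Ps j}"

definition learnt_outer :: "real mat \<Rightarrow> real mat \<Rightarrow> real mat \<Rightarrow> real mat" where
  "learnt_outer M Z Bd =
     four_block_mat (- Z\<^sup>T) M\<^sup>T (0\<^sub>m (dim_col Bd) (dim_row Z)) Bd\<^sup>T"

definition P0_tilde ::
  "real mat \<Rightarrow> real mat \<Rightarrow> real mat \<Rightarrow> real mat set \<Rightarrow> real mat set" where
  "P0_tilde M Z Bd Pd = (\<lambda>P. (learnt_outer M Z Bd)\<^sup>T * P * learnt_outer M Z Bd) ` Pd"

end

theory Submission
  imports Defs
begin

text \<open>Both transformed conditions have the form \<open>[T\<^sup>T; S\<^sup>T]\<^sup>T P [T\<^sup>T; S\<^sup>T] \<succeq> 0\<close> for all multipliers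
  \<open>P\<close>, with \<open>S\<close> of full column rank. On the kernel of \<open>S\<^sup>T\<close> only the left upper block of \<open>P\<close>
  contributes; choosing it negative definite shows \<open>ker S\<^sup>T \<subseteq> ker T\<^sup>T\<close>, hence \<open>T = S \<Delta>\<close>, and since
  \<open>S\<^sup>T\<close> is surjective the condition becomes the original one on \<open>\<Delta>\<close>. This is applied with
  \<open>(T, S) = (X L\<^sub>j, B\<^sub>j)\<close> for each block and with \<open>(T, S) = (M - X Z, B\<^sub>d)\<close>.\<close>

section \<open>Congruences and quadratic forms\<close>

lemma quadratic_form_congruence:
  fixes P X :: "real mat"
  assumes "P \<in> carrier_mat k k" "X \<in> carrier_mat k m" "v \<in> carrier_vec m"
  shows "v \<bullet> ((X\<^sup>T * P * X) *\<^sub>v v) = (X *\<^sub>v v) \<bullet> (P *\<^sub>v (X *\<^sub>v v))"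
proof -
  have [simp]: "X *\<^sub>v v \<in> carrier_vec k" "P *\<^sub>v (X *\<^sub>v v) \<in> carrier_vec k"
    using assms by auto
  have "(X\<^sup>T * P * X) *\<^sub>v v = X\<^sup>T *\<^sub>v (P *\<^sub>v (X *\<^sub>v v))"
    using assms by (simp add: assoc_mult_mat_vec[of _ m k _ m] assoc_mult_mat_vec[of _ m k _ k])
  then show ?thesis
    using transpose_vec_mult_scalar[of "X\<^sup>T" m k "P *\<^sub>v (X *\<^sub>v v)" v] assms by simp
qed

lemma congruence_in_sym_mats:
  assumes "P \<in> sym_mats k" "X \<in> carrier_mat k m"
  shows "X\<^sup>T * P * X \<in> sym_mats m"
proof -
  have P: "P \<in> carrier_mat k k" "P\<^sup>T = P" using assms by (auto simp: sym_mats_def)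
  have "(X\<^sup>T * P * X)\<^sup>T = X\<^sup>T * (X\<^sup>T * P)\<^sup>T"
    using P assms by (intro transpose_mult[of _ m k _ m]) auto
  also have "(X\<^sup>T * P)\<^sup>T = P * X"
    using P assms transpose_mult[of "X\<^sup>T" m k P k] by simp
  also have "X\<^sup>T * (P * X) = X\<^sup>T * P * X"
    using P assms by (intro assoc_mult_mat[symmetric, of _ m k _ k _ m]) auto
  finally show ?thesis using P assms by (simp add: sym_mats_def)
qed

text \<open>Moves an outer factor of a transformed multiplier onto the argument: the form of
  \<open>X\<^sup>T * P * X\<close> at \<open>W\<close> is the form of the original \<open>P\<close>
  at \<open>X * W\<close>.\<close>

lemma congruence_congruence:
  fixes P X W :: "real mat"
  assumes P: "P \<in> carrier_mat k k" and X: "X \<in> carrier_mat k m" and W: "W \<in> carrier_mat m n"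
  shows "W\<^sup>T * (X\<^sup>T * P * X) * W = (X * W)\<^sup>T * P * (X * W)"
proof -
  have "(X * W)\<^sup>T * P * (X * W) = W\<^sup>T * X\<^sup>T * P * (X * W)"
    using X W by (simp add: transpose_mult[of _ k m _ n])
  also have "\<dots> = W\<^sup>T * (X\<^sup>T * P) * (X * W)"
    using P X W by (simp add: assoc_mult_mat[of "W\<^sup>T" n m "X\<^sup>T" k P k])
  also have "\<dots> = W\<^sup>T * (X\<^sup>T * P) * X * W"
    using P X W by (intro assoc_mult_mat[symmetric, of _ n k _ m _ n]) auto
  also have "W\<^sup>T * (X\<^sup>T * P) * X = W\<^sup>T * (X\<^sup>T * P * X)"
    using P X W by (intro assoc_mult_mat[of _ n m _ k _ m]) auto
  finally show ?thesis ..
qed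

text \<open>The symmetry demanded by \<open>psd\<close> is inherited from \<open>P\<close>, so only
  the sign of the form on the range of \<open>X\<close> remains.\<close>

lemma psd_congruence_iff:
  assumes "P \<in> sym_mats k" "X \<in> carrier_mat k m"
  shows "psd (X\<^sup>T * P * X) \<longleftrightarrow>
    (\<forall>v\<in>carrier_vec m. 0 \<le> (X *\<^sub>v v) \<bullet> (P *\<^sub>v (X *\<^sub>v v)))"
proof -
  have P: "P \<in> carrier_mat k k" using assms by (auto simp: sym_mats_def)
  have "dim_row (X\<^sup>T * P * X) = m" using assms by simp
  then show ?thesis
    unfolding psd_def using congruence_in_sym_mats[OF assms] quadratic_form_congruence[OF P assms(2)]
    by simp
qed

section \<open>Entrywise sums of matrices and products with stacked matrices\<close>

lemma mat_sum_carrier [simp]: "mat_sum k p F \<in> carrier_mat k k"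
  by (simp add: mat_sum_def)

lemma mat_sum_in_sym_mats:
  assumes "\<And>i. i < p \<Longrightarrow> F i \<in> sym_mats k"
  shows "mat_sum k p F \<in> sym_mats k"
proof -
  have "F i $$ (b, a) = F i $$ (a, b)" if "i < p" "a < k" "b < k" for i a b
  proof -
    have "F i \<in> carrier_mat k k" "(F i)\<^sup>T = F i" using assms[OF that(1)] by (auto simp: sym_mats_def)
    then show ?thesis using that by (metis carrier_matD index_transpose_mat(1))
  qed
  then show ?thesis by (auto simp: sym_mats_def mat_sum_def intro!: eq_matI)
qed

text \<open>Both sides expand into the same triple sum over two matrix indices and the summand
  index; only the order of summation differs.\<close>

lemma quadratic_form_mat_sum:
  assumes F: "\<And>i. i < p \<Longrightarrow> F i \<in> carrier_mat k k" and w: "w \<in> carrier_vec k"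
  shows "w \<bullet> (mat_sum k p F *\<^sub>v w) = (\<Sum>i<p. w \<bullet> (F i *\<^sub>v w))"
proof -
  have Fw: "w \<bullet> (F i *\<^sub>v w) = (\<Sum>a<k. \<Sum>b<k. w $ a * (F i $$ (a, b) * w $ b))" if "i < p" for i
    using F[OF that] w
    by (auto simp: scalar_prod_def sum_distrib_left lessThan_atLeast0 intro!: sum.cong)
  have "w \<bullet> (mat_sum k p F *\<^sub>v w)
      = (\<Sum>a<k. \<Sum>b<k. \<Sum>i<p. w $ a * (F i $$ (a, b) * w $ b))"
    using w by (auto simp: scalar_prod_def sum_distrib_left sum_distrib_right mat_sum_def lessThan_atLeast0
        intro!: sum.cong)
  also have "\<dots> = (\<Sum>a<k. \<Sum>i<p. \<Sum>b<k. w $ a * (F i $$ (a, b) * w $ b))"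
    by (rule sum.cong[OF refl], rule sum.swap)
  also have "\<dots> = (\<Sum>i<p. \<Sum>a<k. \<Sum>b<k. w $ a * (F i $$ (a, b) * w $ b))"
    by (rule sum.swap)
  finally show ?thesis using Fw by simp
qed

text \<open>\<open>prior_outer\<close> and \<open>learnt_outer\<close> both have a zero lower left
  block; this computes their products with the stack of a transposed uncertainty and the
  identity.\<close>

lemma upper_block_mat_mult_append_one:
  fixes A B D E :: "real mat"
  assumes "A \<in> carrier_mat a c" "B \<in> carrier_mat a p" "D \<in> carrier_mat b p" "E \<in> carrier_mat c p"
  shows "four_block_mat A B (0\<^sub>m b c) D * (E @\<^sub>r 1\<^sub>m p) = (A * E + B) @\<^sub>r D"
proof -
  \<comment> \<open>A stack of two matrices is a four-block matrix whose right blocks have zero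
    columns.\<close>
  have "four_block_mat A B (0\<^sub>m b c) D * four_block_mat E (0\<^sub>m c 0) (1\<^sub>m p) (0\<^sub>m p 0)
     = four_block_mat (A * E + B * 1\<^sub>m p) (A * 0\<^sub>m c 0 + B * 0\<^sub>m p 0)
         (0\<^sub>m b c * E + D * 1\<^sub>m p) (0\<^sub>m b c * 0\<^sub>m c 0 + D * 0\<^sub>m p 0)"
    by (rule mult_four_block_mat) (use assms in auto)
  then show ?thesis using assms by (simp add: append_rows_def)
qed

section \<open>Full column rank, injectivity and right inverses\<close>

lemma eq_mat_mult_vecI:
  fixes X Y :: "'a :: semiring_1 mat"
  assumes X: "X \<in> carrier_mat a b" and Y: "Y \<in> carrier_mat a b"
    and eq: "\<And>v. v \<in> carrier_vec b \<Longrightarrow> X *\<^sub>v v = Y *\<^sub>v v"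
  shows "X = Y"
proof (rule mat_col_eqI)
  fix i assume "i < dim_col Y"
  then have i: "i < b" using Y by simp
  have "col Q i = Q *\<^sub>v unit_vec b i" if "Q \<in> carrier_mat a b" for Q :: "'a mat"
    using col_mult2[OF that one_carrier_mat i] that i by simp
  then show "col X i = col Y i" using X Y eq[of "unit_vec b i"] by simp
qed (use X Y in auto)

text \<open>The rank is the size of a maximal independent subset of the set of columns. A repeated
  column would leave this set with fewer than \<open>p\<close> elements, so the columns are
  distinct; a nonzero kernel vector would then make them dependent.\<close>

lemma full_col_rank_imp_injective:
  assumes S: "S \<in> carrier_mat n p" and rank: "full_col_rank S"
    and v: "v \<in> carrier_vec p" and Sv: "S *\<^sub>v v = 0\<^sub>v n"
  shows "v = 0\<^sub>v p"
proof -
  interpret vec_space "TYPE(real)" n .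
  have r: "rank S = p" using rank S by (auto simp: full_col_rank_def)
  obtain C where C: "maximal C (\<lambda>T. T \<subseteq> set (cols S) \<and> lin_indpt T)"
    using maximal_exists[of "(\<lambda>T. T \<subseteq> set (cols S) \<and> lin_indpt T)" "card (set (cols S))" "{}"]
    by (meson List.finite_set card_mono empty_iff empty_subsetI finite_lin_indpt2 rev_finite_subset)
  then have "p \<le> card (set (cols S))"
    using rank_card_indpt[OF S C] r by (simp add: card_mono maximal_def)
  then have d: "distinct (cols S)"
    using S card_distinct[of "cols S"] card_length[of "cols S"] by simp
  show ?thesis
    using full_rank_lin_indpt[OF S r d] lin_depI[OF S v _ Sv d] by blast
qed

lemma scalar_prod_self_eq_0:
  fixes v :: "real vec"
  assumes "v \<in> carrier_vec n" "v \<bullet> v = 0"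
  shows "v = 0\<^sub>v n"
  using assms by (auto simp: scalar_prod_def sum_nonneg_eq_0_iff)

text \<open>If the Gram matrix \<open>S\<^sup>T * S\<close> annihilates \<open>v\<close>, then
  \<open>S *\<^sub>v v\<close> has norm zero and \<open>v\<close> vanishes by injectivity. So the
  Gram matrix has an inverse \<open>K\<close>, and \<open>S * K\<close> is the required right
  inverse.\<close>

lemma full_col_rank_obtains_right_inverse:
  assumes S: "S \<in> carrier_mat n p" and rank: "full_col_rank S"
  obtains H where "H \<in> carrier_mat n p" "S\<^sup>T * H = 1\<^sub>m p"
proof -
  have G: "S\<^sup>T * S \<in> carrier_mat p p" using S by simp
  have "v = 0\<^sub>v p" if v: "v \<in> carrier_vec p" and "(S\<^sup>T * S) *\<^sub>v v = 0\<^sub>v p" for v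
  proof -
    have "S\<^sup>T *\<^sub>v (S *\<^sub>v v) = 0\<^sub>v p"
      using that S by (simp add: assoc_mult_mat_vec[of _ p n _ p])
    then have "(S *\<^sub>v v) \<bullet> (S *\<^sub>v v) = 0"
      using transpose_vec_mult_scalar[OF S v, of "S *\<^sub>v v"] S v by simp
    then have "S *\<^sub>v v = 0\<^sub>v n"
      using scalar_prod_self_eq_0[of "S *\<^sub>v v" n] S v by simp
    then show ?thesis by (rule full_col_rank_imp_injective[OF S rank v])
  qed
  then have "det (S\<^sup>T * S) \<noteq> 0"
    using det_0_iff_vec_prod_zero_field[OF G] by blast
  from det_non_zero_imp_unit[OF G this]
  obtain K where K: "K \<in> carrier_mat p p" "S\<^sup>T * S * K = 1\<^sub>m p"
    by (auto simp: Units_def ring_mat_def)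
  show ?thesis
    using that[of "S * K"] K S by (simp add: assoc_mult_mat[of _ p n _ p])
qed

section \<open>Factorisation from the multiplier inequalities\<close>

text \<open>Entry point of the negative definite block: for \<open>v\<close> in the kernel of
  \<open>S\<^sup>T\<close>, the stacked vector has zero lower part.\<close>

lemma quadratic_form_append_zero:
  fixes P :: "real mat"
  assumes P: "P \<in> carrier_mat (q + p) (q + p)" and v: "v \<in> carrier_vec q"
  shows "(v @\<^sub>v 0\<^sub>v p) \<bullet> (P *\<^sub>v (v @\<^sub>v 0\<^sub>v p)) = v \<bullet> (left_upper q P *\<^sub>v v)"
proof -
  define A B C D where "A = left_upper q P" and "B = mat q p (\<lambda>(i, j). P $$ (i, j + q))"
    and "C = mat p q (\<lambda>(i, j). P $$ (i + q, j))" and "D = mat p p (\<lambda>(i, j). P $$ (i + q, j + q))"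
  note defs = A_def B_def C_def D_def
  have A: "A \<in> carrier_mat q q" and B: "B \<in> carrier_mat q p"
    and C: "C \<in> carrier_mat p q" and D: "D \<in> carrier_mat p p"
    by (simp_all add: defs left_upper_def)
  have "P = four_block_mat A B C D"
    using P by (auto simp: defs left_upper_def intro!: eq_matI)
  then have "P *\<^sub>v (v @\<^sub>v 0\<^sub>v p) = (A *\<^sub>v v + B *\<^sub>v 0\<^sub>v p) @\<^sub>v (C *\<^sub>v v + D *\<^sub>v 0\<^sub>v p)"
    using four_block_mat_mult_vec[OF A B C D v zero_carrier_vec] by simp
  moreover have "B *\<^sub>v 0\<^sub>v p = 0\<^sub>v q" using B by auto
  ultimately have Pv: "P *\<^sub>v (v @\<^sub>v 0\<^sub>v p) = (A *\<^sub>v v) @\<^sub>v (C *\<^sub>v v + D *\<^sub>v 0\<^sub>v p)"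
    using mult_mat_vec_carrier[OF A v] by simp
  have lower: "C *\<^sub>v v + D *\<^sub>v 0\<^sub>v p \<in> carrier_vec p"
    by (intro add_carrier_vec mult_mat_vec_carrier[OF C v] mult_mat_vec_carrier[OF D zero_carrier_vec])
  show ?thesis
    unfolding Pv scalar_prod_append[OF v zero_carrier_vec mult_mat_vec_carrier[OF A v] lower]
    using lower by (simp add: A_def)
qed

lemma psd_append_iff_factor:
  assumes S: "S \<in> carrier_mat n p" and rank: "full_col_rank S" and T: "T \<in> carrier_mat n q"
    and C: "C \<subseteq> sym_mats (q + p)" and neg: "\<exists>P\<in>C. neg_def (left_upper q P)"
  shows "(\<forall>P\<in>C. psd ((T\<^sup>T @\<^sub>r S\<^sup>T)\<^sup>T * P * (T\<^sup>T @\<^sub>r S\<^sup>T))) \<longleftrightarrow>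
    (\<exists>\<Delta>\<in>quad_set p q C. T = S * \<Delta>)"
proof
  have TS: "T\<^sup>T @\<^sub>r S\<^sup>T \<in> carrier_mat (q + p) n" using S T by auto
  have form: "psd ((T\<^sup>T @\<^sub>r S\<^sup>T)\<^sup>T * P * (T\<^sup>T @\<^sub>r S\<^sup>T)) \<longleftrightarrow>
    (\<forall>v\<in>carrier_vec n. 0 \<le> ((T\<^sup>T *\<^sub>v v) @\<^sub>v (S\<^sup>T *\<^sub>v v)) \<bullet> (P *\<^sub>v ((T\<^sup>T *\<^sub>v v) @\<^sub>v (S\<^sup>T *\<^sub>v v))))"
    if "P \<in> C" for P
  proof -
    have "P \<in> sym_mats (q + p)" using that C by blast
    from psd_congruence_iff[OF this TS] show ?thesis
      using S T by (simp add: mat_mult_append[of _ q n _ p])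
  qed
  have form1: "psd ((\<Delta>\<^sup>T @\<^sub>r 1\<^sub>m p)\<^sup>T * P * (\<Delta>\<^sup>T @\<^sub>r 1\<^sub>m p)) \<longleftrightarrow>
    (\<forall>v\<in>carrier_vec p. 0 \<le> ((\<Delta>\<^sup>T *\<^sub>v v) @\<^sub>v v) \<bullet> (P *\<^sub>v ((\<Delta>\<^sup>T *\<^sub>v v) @\<^sub>v v)))"
    if "P \<in> C" "\<Delta> \<in> carrier_mat p q" for P \<Delta>
  proof -
    have "\<Delta>\<^sup>T @\<^sub>r 1\<^sub>m p \<in> carrier_mat (q + p) p" "P \<in> sym_mats (q + p)" using that C by auto
    from psd_congruence_iff[OF this(2,1)] show ?thesis
      using that by (simp add: mat_mult_append[of _ q p _ p])
  qed
  {
    assume "\<exists>\<Delta>\<in>quad_set p q C. T = S * \<Delta>"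
    then obtain \<Delta> where \<Delta>: "\<Delta> \<in> quad_set p q C" "\<Delta> \<in> carrier_mat p q" "T = S * \<Delta>"
      by (auto simp: quad_set_def)
    \<comment> \<open>The stacked vector of \<open>(T, S)\<close> at \<open>v\<close> is the stacked
      vector of \<open>\<Delta>\<close> at \<open>S\<^sup>T *\<^sub>v v\<close>, so the inequalities
      for \<open>\<Delta>\<close> carry over.\<close>
    have TD: "T\<^sup>T *\<^sub>v v = \<Delta>\<^sup>T *\<^sub>v (S\<^sup>T *\<^sub>v v)" if "v \<in> carrier_vec n" for v
      using \<Delta> S that by (simp add: transpose_mult[of _ n p _ q] assoc_mult_mat_vec[of _ q p _ n])
    have "S\<^sup>T *\<^sub>v v \<in> carrier_vec p" if "v \<in> carrier_vec n" for v
      using S that by simp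
    then show "\<forall>P\<in>C. psd ((T\<^sup>T @\<^sub>r S\<^sup>T)\<^sup>T * P * (T\<^sup>T @\<^sub>r S\<^sup>T))"
      using \<Delta>(1) form form1[OF _ \<Delta>(2)] TD by (simp add: quad_set_def)
  }
  assume psd: "\<forall>P\<in>C. psd ((T\<^sup>T @\<^sub>r S\<^sup>T)\<^sup>T * P * (T\<^sup>T @\<^sub>r S\<^sup>T))"
  obtain H where H: "H \<in> carrier_mat n p" "S\<^sup>T * H = 1\<^sub>m p"
    using full_col_rank_obtains_right_inverse[OF S rank] .
  obtain N where N: "N \<in> C" "neg_def (left_upper q N)" using neg by blast
  then have Nc: "N \<in> carrier_mat (q + p) (q + p)" using C by (auto simp: sym_mats_def)
  \<comment> \<open>On such \<open>v\<close> the form of \<open>N\<close> is nonnegative by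
    hypothesis, yet it would be negative if \<open>T\<^sup>T *\<^sub>v v\<close> were
    nonzero.\<close>
  have ker: "T\<^sup>T *\<^sub>v v = 0\<^sub>v q" if v: "v \<in> carrier_vec n" and Sv: "S\<^sup>T *\<^sub>v v = 0\<^sub>v p" for v
  proof (rule ccontr)
    have Tv: "T\<^sup>T *\<^sub>v v \<in> carrier_vec q" using T v by simp
    assume "T\<^sup>T *\<^sub>v v \<noteq> 0\<^sub>v q"
    then have "0 < (T\<^sup>T *\<^sub>v v) \<bullet> (- left_upper q N *\<^sub>v (T\<^sup>T *\<^sub>v v))"
      using N(2) Tv unfolding neg_def_def pos_def_def left_upper_def by (auto simp del: uminus_mult_mat_vec)
    moreover have "0 \<le> (T\<^sup>T *\<^sub>v v) \<bullet> (left_upper q N *\<^sub>v (T\<^sup>T *\<^sub>v v))"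
      using psd N(1) form v Sv quadratic_form_append_zero[OF Nc Tv] by fastforce
    ultimately show False using T v by (simp add: left_upper_def)
  qed
  \<comment> \<open>This choice is forced: \<open>T = S * \<Delta>\<close> transposed and multiplied
    by \<open>H\<close> on the right gives \<open>T\<^sup>T * H = \<Delta>\<^sup>T\<close>.\<close>
  define \<Delta> where "\<Delta> = (T\<^sup>T * H)\<^sup>T"
  have \<Delta>: "\<Delta> \<in> carrier_mat p q" using T H by (simp add: \<Delta>_def)
  have TD: "T\<^sup>T *\<^sub>v v = \<Delta>\<^sup>T *\<^sub>v (S\<^sup>T *\<^sub>v v)" if v: "v \<in> carrier_vec n" for v
  proof -
    have Hv: "H *\<^sub>v (S\<^sup>T *\<^sub>v v) \<in> carrier_vec n" using H S v by auto
    have "S\<^sup>T *\<^sub>v (H *\<^sub>v (S\<^sup>T *\<^sub>v v)) = S\<^sup>T *\<^sub>v v"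
      using H S v assoc_mult_mat_vec[of "S\<^sup>T" p n H p "S\<^sup>T *\<^sub>v v"] by simp
    \<comment> \<open>The difference between \<open>v\<close> and its image under
      \<open>H * S\<^sup>T\<close> lies in the kernel of \<open>S\<^sup>T\<close>, hence in that of
      \<open>T\<^sup>T\<close>.\<close>
    then have "S\<^sup>T *\<^sub>v (v - H *\<^sub>v (S\<^sup>T *\<^sub>v v)) = 0\<^sub>v p"
      using S v Hv by (simp add: mult_minus_distrib_mat_vec[of _ p n])
    then have "T\<^sup>T *\<^sub>v (v - H *\<^sub>v (S\<^sup>T *\<^sub>v v)) = 0\<^sub>v q"
      using ker v Hv by simp
    then have eq: "T\<^sup>T *\<^sub>v v - T\<^sup>T *\<^sub>v (H *\<^sub>v (S\<^sup>T *\<^sub>v v)) = 0\<^sub>v q"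
      using T v Hv by (simp add: mult_minus_distrib_mat_vec[of _ q n])
    have "T\<^sup>T *\<^sub>v v = T\<^sup>T *\<^sub>v (H *\<^sub>v (S\<^sup>T *\<^sub>v v))"
    proof (rule eq_vecI)
      fix i assume "i < dim_vec (T\<^sup>T *\<^sub>v (H *\<^sub>v (S\<^sup>T *\<^sub>v v)))"
      then have "i < q" using T by simp
      then show "(T\<^sup>T *\<^sub>v v) $ i = (T\<^sup>T *\<^sub>v (H *\<^sub>v (S\<^sup>T *\<^sub>v v))) $ i"
        using arg_cong[OF eq, of "\<lambda>u. u $ i"] T by simp
    qed simp
    also have "\<dots> = \<Delta>\<^sup>T *\<^sub>v (S\<^sup>T *\<^sub>v v)"
      using T H S v by (simp add: \<Delta>_def assoc_mult_mat_vec[of _ q n _ p])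
    finally show ?thesis .
  qed
  have "T\<^sup>T = \<Delta>\<^sup>T * S\<^sup>T"
    using T S \<Delta> TD by (intro eq_mat_mult_vecI[of _ q n]) (auto simp: assoc_mult_mat_vec[of _ q p _ n])
  then have "T\<^sup>T = (S * \<Delta>)\<^sup>T" using S \<Delta> by (simp add: transpose_mult[of _ n p _ q])
  then have fac: "T = S * \<Delta>" by simp
  have "psd ((\<Delta>\<^sup>T @\<^sub>r 1\<^sub>m p)\<^sup>T * P * (\<Delta>\<^sup>T @\<^sub>r 1\<^sub>m p))" if P: "P \<in> C" for P
    unfolding form1[OF P \<Delta>]
  proof
    fix u :: "real vec" assume u: "u \<in> carrier_vec p"
    \<comment> \<open>Surjectivity of \<open>S\<^sup>T\<close> in use: an arbitrary \<open>u\<close>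
      is reached from the test vector \<open>H *\<^sub>v u\<close>.\<close>
    have Hu: "H *\<^sub>v u \<in> carrier_vec n" using H u by auto
    have "S\<^sup>T *\<^sub>v (H *\<^sub>v u) = u"
      using H S u assoc_mult_mat_vec[of "S\<^sup>T" p n H p u] by simp
    then show "0 \<le> ((\<Delta>\<^sup>T *\<^sub>v u) @\<^sub>v u) \<bullet> (P *\<^sub>v ((\<Delta>\<^sup>T *\<^sub>v u) @\<^sub>v u))"
      using form[OF P] psd P Hu TD[OF Hu] by force
  qed
  then have "\<Delta> \<in> quad_set p q C" using \<Delta> by (simp add: quad_set_def)
  then show "\<exists>\<Delta>\<in>quad_set p q C. T = S * \<Delta>" using fac by blast
qed

section \<open>Block columns of the identity and block diagonal matrices\<close>

lemma id_block_col_carrier [simp]: "id_block_col K ks j \<in> carrier_mat K (ks j)"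
  by (simp add: id_block_col_def)

lemma block_offset_le:
  fixes ks :: "nat \<Rightarrow> nat"
  assumes "j < l"
  shows "(\<Sum>i<j. ks i) + ks j \<le> (\<Sum>i<l. ks i)"
  using sum_mono2[of "{..<l}" "{..<Suc j}" ks] assms by auto

lemma block_index_obtain:
  fixes ks :: "nat \<Rightarrow> nat"
  assumes "c < (\<Sum>i<l. ks i)"
  obtains j c' where "j < l" "c' < ks j" "c = (\<Sum>i<j. ks i) + c'"
  using assms
proof (induction l arbitrary: thesis)
  case (Suc l)
  show ?case
  proof (cases "c < (\<Sum>i<l. ks i)")
    case True
    then show ?thesis using Suc.IH Suc.prems(1) less_Suc_eq by metis
  next
    case False
    then show ?thesis using Suc.prems by (intro Suc.prems(1)[of l "c - (\<Sum>i<l. ks i)"]) auto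
  qed
qed simp

lemma mult_id_block_col_index:
  assumes X: "X \<in> carrier_mat n K" and j: "(\<Sum>i<j. ks i) + ks j \<le> K" and r: "r < n" and c: "c < ks j"
  shows "(X * id_block_col K ks j) $$ (r, c) = X $$ (r, (\<Sum>i<j. ks i) + c)"
proof -
  have "(X * id_block_col K ks j) $$ (r, c)
      = (\<Sum>k = 0..<K. X $$ (r, k) * (if k = (\<Sum>i<j. ks i) + c then 1 else 0))"
    using assms by (auto simp: id_block_col_def scalar_prod_def intro!: sum.cong)
  also have "\<dots> = X $$ (r, (\<Sum>i<j. ks i) + c)"
    using j c by (simp add: if_distrib cong: if_cong)
  finally show ?thesis .
qed

lemma id_block_col_mult_index:
  assumes Y: "Y \<in> carrier_mat (ks j) m" and j: "(\<Sum>i<j. ks i) + ks j \<le> K" and r: "r < K" and c: "c < m"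
  shows "(id_block_col K ks j * Y) $$ (r, c) =
    (if (\<Sum>i<j. ks i) \<le> r \<and> r < (\<Sum>i<j. ks i) + ks j then Y $$ (r - (\<Sum>i<j. ks i), c) else 0)"
proof -
  have "(id_block_col K ks j * Y) $$ (r, c)
      = (\<Sum>k = 0..<ks j. (if r = (\<Sum>i<j. ks i) + k then 1 else 0) * Y $$ (k, c))"
    using assms by (auto simp: id_block_col_def scalar_prod_def intro!: sum.cong)
  \<comment> \<open>Solving for \<open>k\<close> uses truncated subtraction, so the test that
    \<open>r\<close> is not below the offset must stay: otherwise every smaller \<open>r\<close>
    would match \<open>k = 0\<close>.\<close>
  also have "\<dots> = (\<Sum>k = 0..<ks j. if k = r - (\<Sum>i<j. ks i) then
      (if (\<Sum>i<j. ks i) \<le> r then Y $$ (k, c) else 0) else 0)"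
    by (intro sum.cong) auto
  also have "\<dots> = (if (\<Sum>i<j. ks i) \<le> r \<and> r < (\<Sum>i<j. ks i) + ks j
      then Y $$ (r - (\<Sum>i<j. ks i), c) else 0)"
    by auto
  finally show ?thesis .
qed

text \<open>Multiplying by \<open>id_block_col\<close> on the right extracts a block of columns, and
  since the widths sum to \<open>K\<close> these blocks cover all columns.\<close>

lemma eq_mat_id_block_colI:
  assumes X: "X \<in> carrier_mat n K" and Y: "Y \<in> carrier_mat n K" and K: "(\<Sum>j<l. ks j) = K"
    and eq: "\<And>j. j < l \<Longrightarrow> X * id_block_col K ks j = Y * id_block_col K ks j"
  shows "X = Y"
proof (rule eq_matI)
  fix r c assume rc: "r < dim_row Y" "c < dim_col Y"
  then have r: "r < n" using Y by simp
  obtain j c' where j: "j < l" "c' < ks j" "c = (\<Sum>i<j. ks i) + c'"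
    using block_index_obtain[of c ks l] rc Y K by auto
  have "(\<Sum>i<j. ks i) + ks j \<le> K" using block_offset_le[OF j(1), of ks] K by simp
  from mult_id_block_col_index[of _ n K ks j r c', OF _ this r j(2)]
  show "X $$ (r, c) = Y $$ (r, c)" using X Y eq[OF j(1)] j(3) by metis
qed (use X Y in auto)

lemma diag_block_mat_carrier:
  assumes "\<And>j. j < l \<Longrightarrow> \<Delta>s j \<in> carrier_mat (rs j) (cs j)"
  shows "diag_block_mat (map \<Delta>s [0..<l]) \<in> carrier_mat (\<Sum>j<l. rs j) (\<Sum>j<l. cs j)"
proof -
  have "map (dim_row \<circ> \<Delta>s) [0..<l] = map rs [0..<l]" "map (dim_col \<circ> \<Delta>s) [0..<l] = map cs [0..<l]"
    using carrier_matD[OF assms] by auto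
  then show ?thesis
    unfolding carrier_mat_def mem_Collect_eq dim_diag_block_mat map_map lessThan_atLeast0
    by (simp only: interv_sum_list_conv_sum_set_nat set_upt)
qed

lemma diag_block_mat_index:
  assumes "\<And>j. j < l \<Longrightarrow> \<Delta>s j \<in> carrier_mat (rs j) (cs j)"
    and "j < l" "r < (\<Sum>i<l. rs i)" "c < cs j"
  shows "diag_block_mat (map \<Delta>s [0..<l]) $$ (r, (\<Sum>i<j. cs i) + c) =
    (if (\<Sum>i<j. rs i) \<le> r \<and> r < (\<Sum>i<j. rs i) + rs j then \<Delta>s j $$ (r - (\<Sum>i<j. rs i), c) else 0)"
  using assms
proof (induction l)
  case (Suc l)
  let ?D = "diag_block_mat (map \<Delta>s [0..<l])"
  have D: "?D \<in> carrier_mat (\<Sum>j<l. rs j) (\<Sum>j<l. cs j)"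
    using Suc.prems by (intro diag_block_mat_carrier) auto
  have l: "\<Delta>s l \<in> carrier_mat (rs l) (cs l)" using Suc.prems by simp
  \<comment> \<open>The induction adds the last block as a lower right corner; column block
    \<open>j\<close> then lies either in the old part, padded by zeros below, or in the new
    corner.\<close>
  have split: "diag_block_mat (map \<Delta>s [0..<Suc l]) = four_block_mat ?D (0\<^sub>m (\<Sum>j<l. rs j) (cs l))
     (0\<^sub>m (rs l) (\<Sum>j<l. cs j)) (\<Delta>s l)"
    using D l by (simp add: diag_block_mat_last Let_def)
  show ?case
  proof (cases "j < l")
    case True
    have "(\<Sum>i<j. cs i) + cs j \<le> (\<Sum>i<l. cs i)" "(\<Sum>i<j. rs i) + rs j \<le> (\<Sum>i<l. rs i)"
      using True by (auto intro: block_offset_le)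
    then show ?thesis
      unfolding split using Suc.IH[OF _ True] Suc.prems(1,3,4) True carrier_matD[OF D] carrier_matD[OF l]
      by (cases "r < (\<Sum>i<l. rs i)") auto
  next
    case False
    then have "j = l" using Suc.prems by simp
    then show ?thesis
      unfolding split using Suc.prems(3,4) carrier_matD[OF D] carrier_matD[OF l] by auto
  qed
qed simp

text \<open>With L_j and R_j the block columns of the two identities, this is \<Delta> L_j = R_j
  \<Delta>_j, the form in which block diagonality enters: it gives B_w \<Delta> L_j = B_j
  \<Delta>_j.\<close>

lemma diag_block_mat_mult_id_block_col:
  fixes \<Delta>s :: "nat \<Rightarrow> real mat"
  assumes \<Delta>s: "\<And>j. j < l \<Longrightarrow> \<Delta>s j \<in> carrier_mat (rs j) (cs j)"
    and R: "(\<Sum>j<l. rs j) = R" and C: "(\<Sum>j<l. cs j) = C" and j: "j < l"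
  shows "diag_block_mat (map \<Delta>s [0..<l]) * id_block_col C cs j = id_block_col R rs j * \<Delta>s j"
    (is "?D * _ = _")
proof (rule eq_matI)
  have D: "?D \<in> carrier_mat R C" using diag_block_mat_carrier[of l \<Delta>s rs cs, OF \<Delta>s] R C by simp
  have off: "(\<Sum>i<j. cs i) + cs j \<le> C" "(\<Sum>i<j. rs i) + rs j \<le> R"
    using block_offset_le[OF j] R C by auto
  show "dim_row (?D * id_block_col C cs j) = dim_row (id_block_col R rs j * \<Delta>s j)"
    "dim_col (?D * id_block_col C cs j) = dim_col (id_block_col R rs j * \<Delta>s j)"
    using D \<Delta>s[OF j] by (auto simp: id_block_col_def)
  fix r c assume "r < dim_row (id_block_col R rs j * \<Delta>s j)" "c < dim_col (id_block_col R rs j * \<Delta>s j)"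
  then have rc: "r < R" "c < cs j" using \<Delta>s[OF j] by (auto simp: id_block_col_def)
  show "(?D * id_block_col C cs j) $$ (r, c) = (id_block_col R rs j * \<Delta>s j) $$ (r, c)"
    using mult_id_block_col_index[OF D off(1) rc] id_block_col_mult_index[OF \<Delta>s[OF j] off(2) rc]
      diag_block_mat_index[of l \<Delta>s rs cs j r c, OF \<Delta>s j _ rc(2)] rc R by simp
qed

section \<open>The two transformed sets, the learnt one first and then the prior one\<close>

lemma minus_mat_eq_iff:
  fixes A B C :: "'a :: ab_group_add mat"
  assumes "A \<in> carrier_mat n m" "B \<in> carrier_mat n m" "C \<in> carrier_mat n m"
  shows "A - B = C \<longleftrightarrow> A = B + C"
  using carrier_matD[OF assms(1)] carrier_matD[OF assms(2)] carrier_matD[OF assms(3)]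
  by (simp add: mat_eq_iff diff_eq_eq add.commute)

text \<open>The outer factor turns the stack of \<open>X\<^sup>T\<close> and the identity into that
  of the transposes of \<open>M - X * Z\<close> and \<open>Bd\<close>. The factor supplied by
  \<open>psd_append_iff_factor\<close> is then the disturbance matrix explaining the
  residual.\<close>

lemma quad_set_P0_tilde_iff:
  assumes M: "M \<in> carrier_mat n N" and Z: "Z \<in> carrier_mat nz N" and Bd: "Bd \<in> carrier_mat n nd"
    and rank: "full_col_rank Bd" and Pd: "Pd \<subseteq> sym_mats (N + nd)"
    and neg: "\<exists>P\<in>Pd. neg_def (left_upper N P)" and X: "X \<in> carrier_mat n nz"
  shows "X \<in> quad_set n nz (P0_tilde M Z Bd Pd) \<longleftrightarrow> (\<exists>D\<in>quad_set nd N Pd. M = X * Z + Bd * D)"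
proof -
  let ?W = "X\<^sup>T @\<^sub>r 1\<^sub>m n" and ?O = "learnt_outer M Z Bd"
  have W: "?W \<in> carrier_mat (nz + n) n" using X by simp
  have O: "?O \<in> carrier_mat (N + nd) (nz + n)"
    using M Z Bd unfolding learnt_outer_def by auto
  have MXZ: "M - X * Z \<in> carrier_mat n N" using M X Z by auto
  have "- Z\<^sup>T * X\<^sup>T + M\<^sup>T = (M - X * Z)\<^sup>T"
    using M X Z by (simp add: transpose_minus[of _ n N] transpose_mult[of _ n nz _ N])
      (intro eq_matI; simp)
  then have OW: "?O * ?W = (M - X * Z)\<^sup>T @\<^sub>r Bd\<^sup>T"
    using upper_block_mat_mult_append_one[of "- Z\<^sup>T" N nz "M\<^sup>T" n "Bd\<^sup>T" nd "X\<^sup>T"] M X Z Bd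
    by (simp add: learnt_outer_def)
  have "?W\<^sup>T * (?O\<^sup>T * P * ?O) * ?W = (?O * ?W)\<^sup>T * P * (?O * ?W)" if "P \<in> Pd" for P
  proof -
    have "P \<in> carrier_mat (N + nd) (N + nd)" using that Pd by (auto simp: sym_mats_def)
    then show ?thesis using congruence_congruence[OF _ O W] by simp
  qed
  then have "X \<in> quad_set n nz (P0_tilde M Z Bd Pd) \<longleftrightarrow>
      (\<forall>P\<in>Pd. psd (((M - X * Z)\<^sup>T @\<^sub>r Bd\<^sup>T)\<^sup>T * P * ((M - X * Z)\<^sup>T @\<^sub>r Bd\<^sup>T)))"
    using X OW by (auto simp: quad_set_def P0_tilde_def)
  also have "\<dots> \<longleftrightarrow> (\<exists>D\<in>quad_set nd N Pd. M - X * Z = Bd * D)"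
    by (rule psd_append_iff_factor[OF Bd rank MXZ Pd neg])
  also have "\<dots> \<longleftrightarrow> (\<exists>D\<in>quad_set nd N Pd. M = X * Z + Bd * D)"
  proof (rule bex_cong[OF refl])
    fix D assume "D \<in> quad_set nd N Pd"
    then have BD: "Bd * D \<in> carrier_mat n N" using Bd by (auto simp: quad_set_def)
    have XZ: "X * Z \<in> carrier_mat n N" using X Z by simp
    show "M - X * Z = Bd * D \<longleftrightarrow> M = X * Z + Bd * D"
      by (rule minus_mat_eq_iff[OF M XZ BD])
  qed
  finally show ?thesis .
qed

text \<open>Positive scalings alone separate the blocks: letting the multipliers of all other blocks tend
  to zero leaves the form of a single block.\<close>

lemma cone_forms_nonneg_sum_iff:
  fixes q :: "nat \<Rightarrow> real mat \<Rightarrow> real"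
  assumes ne: "\<And>j. j < l \<Longrightarrow> Ps j \<noteq> {}"
    and cone: "\<And>j P c. j < l \<Longrightarrow> P \<in> Ps j \<Longrightarrow> c > 0 \<Longrightarrow> c \<cdot>\<^sub>m P \<in> Ps j"
    and hom: "\<And>j P c. j < l \<Longrightarrow> P \<in> Ps j \<Longrightarrow> q j (c \<cdot>\<^sub>m P) = c * q j P"
  shows "(\<forall>P. (\<forall>j<l. P j \<in> Ps j) \<longrightarrow> 0 \<le> (\<Sum>j<l. q j (P j))) \<longleftrightarrow> (\<forall>j<l. \<forall>P\<in>Ps j. 0 \<le> q j P)"
proof
  assume all: "\<forall>P. (\<forall>j<l. P j \<in> Ps j) \<longrightarrow> 0 \<le> (\<Sum>j<l. q j (P j))"
  \<comment> \<open>Any fixed multiplier serves in the blocks other than the one under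
    examination.\<close>
  define Q where "Q j = (SOME P. P \<in> Ps j)" for j
  have Q: "Q j \<in> Ps j" if "j < l" for j using ne[OF that] by (simp add: Q_def some_in_eq)
  show "\<forall>j<l. \<forall>P\<in>Ps j. 0 \<le> q j P"
  proof (intro allI impI ballI)
    fix j P assume j: "j < l" and P: "P \<in> Ps j"
    define s where "s = (\<Sum>i\<in>{..<l} - {j}. q i (Q i))"
    \<comment> \<open>Tested on \<open>P\<close> in block \<open>j\<close> and on
      \<open>e \<cdot>\<^sub>m Q i\<close> in every other block \<open>i\<close>; homogeneity
      collects the other blocks into \<open>e * s\<close>.\<close>
    have ge: "0 \<le> q j P + e * s" if e: "e > 0" for e
    proof -
      have "0 \<le> (\<Sum>i<l. q i (if i = j then P else e \<cdot>\<^sub>m Q i))"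
        using all j P Q cone e by simp
      also have "\<dots> = q j P + (\<Sum>i\<in>{..<l} - {j}. q i (if i = j then P else e \<cdot>\<^sub>m Q i))"
        using j by (subst sum.remove[of _ j]) auto
      also have "(\<Sum>i\<in>{..<l} - {j}. q i (if i = j then P else e \<cdot>\<^sub>m Q i)) = e * s"
        using hom Q by (auto simp: s_def sum_distrib_left intro!: sum.cong)
      finally show ?thesis .
    qed
    show "0 \<le> q j P"
    proof (rule field_le_epsilon)
      fix e :: real assume e: "e > 0"
      \<comment> \<open>With this scaling the remainder is at most \<open>e\<close>; the added one
        keeps the denominator positive when \<open>s = 0\<close>.\<close>
      have "e / (\<bar>s\<bar> + 1) * s \<le> e / (\<bar>s\<bar> + 1) * (\<bar>s\<bar> + 1)"
        using e by (intro mult_left_mono) auto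
      then show "0 \<le> q j P + e" using ge[of "e / (\<bar>s\<bar> + 1)"] e by (simp add: add_pos_nonneg)
    qed
  qed
qed (auto intro!: sum_nonneg)

text \<open>At a fixed vector, the form of a summed multiplier is a sum of one form per block. The
  block multipliers vary independently in their cones, so the sum is nonnegative for all choices
  exactly when every block is, and each block condition is a factorisation through B_j.\<close>

lemma quad_set_P_tilde_iff:
  assumes Bw: "Bw \<in> carrier_mat n nw"
    and rank: "\<And>j. j < l \<Longrightarrow> full_col_rank (Bw * id_block_col nw nws j)"
    and cone: "\<And>j. j < l \<Longrightarrow> convex_cone_of_sym (nzs j + nws j) (Ps j)"
    and neg: "\<And>j. j < l \<Longrightarrow> \<exists>P\<in>Ps j. neg_def (left_upper (nzs j) P)"
    and X: "X \<in> carrier_mat n nz"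
  shows "X \<in> quad_set n nz (P_tilde Bw nz l nws nzs Ps) \<longleftrightarrow>
    (\<forall>j<l. \<exists>\<Delta>\<in>quad_set (nws j) (nzs j) (Ps j).
      X * id_block_col nz nzs j = Bw * id_block_col nw nws j * \<Delta>)"
proof -
  let ?W = "X\<^sup>T @\<^sub>r 1\<^sub>m n" and ?O = "prior_outer Bw nz nws nzs"
    and ?L = "id_block_col nz nzs" and ?B = "\<lambda>j. Bw * id_block_col nw nws j"
  let ?Y = "\<lambda>j. (X * ?L j)\<^sup>T @\<^sub>r (?B j)\<^sup>T"
  let ?q = "\<lambda>v j P. (?Y j *\<^sub>v v) \<bullet> (P *\<^sub>v (?Y j *\<^sub>v v))"
  let ?F = "\<lambda>P j. (?O j)\<^sup>T * P j * ?O j"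
  have W: "?W \<in> carrier_mat (nz + n) n" using X by simp
  have B: "?B j \<in> carrier_mat n (nws j)" and XL: "X * ?L j \<in> carrier_mat n (nzs j)" for j
    using Bw X by (auto intro!: mult_carrier_mat)
  have O: "?O j \<in> carrier_mat (nzs j + nws j) (nz + n)" for j
    using B[of j] Bw by (auto simp: prior_outer_def Let_def)
  have Y: "?Y j \<in> carrier_mat (nzs j + nws j) n" for j using B XL by auto
  have sym: "Ps j \<subseteq> sym_mats (nzs j + nws j)" if "j < l" for j
    using cone[OF that] by (simp add: convex_cone_of_sym_def)
  \<comment> \<open>This identifies the pair for block \<open>j\<close> as
    \<open>T = X * ?L j\<close> and \<open>S = ?B j\<close>.\<close>
  have OW: "?O j * ?W = ?Y j" for j
  proof -
    have LX: "(X * ?L j)\<^sup>T = (?L j)\<^sup>T * X\<^sup>T"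
      by (rule transpose_mult[OF X id_block_col_carrier])
    have "(X * ?L j)\<^sup>T \<in> carrier_mat (nzs j) n" using XL by simp
    from right_add_zero_mat[OF this] have "(?L j)\<^sup>T * X\<^sup>T + 0\<^sub>m (nzs j) n = (X * ?L j)\<^sup>T"
      unfolding LX .
    then show ?thesis
      using upper_block_mat_mult_append_one[of "(?L j)\<^sup>T" "nzs j" nz "0\<^sub>m (nzs j) n" n "(?B j)\<^sup>T"
          "nws j" "X\<^sup>T"] B[of j] Bw X
      by (simp add: prior_outer_def Let_def)
  qed
  have tilde: "psd (?W\<^sup>T * mat_sum (nz + n) l (?F P) * ?W) \<longleftrightarrow>
      (\<forall>v\<in>carrier_vec n. 0 \<le> (\<Sum>j<l. ?q v j (P j)))"
    if P: "\<And>j. j < l \<Longrightarrow> P j \<in> Ps j" for P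
  proof -
    have F: "?F P j \<in> sym_mats (nz + n)" if "j < l" for j
      using P[OF that] sym[OF that] O congruence_in_sym_mats by blast
    have "(?W *\<^sub>v v) \<bullet> (mat_sum (nz + n) l (?F P) *\<^sub>v (?W *\<^sub>v v)) = (\<Sum>j<l. ?q v j (P j))"
      if v: "v \<in> carrier_vec n" for v
    proof -
      have Wv: "?W *\<^sub>v v \<in> carrier_vec (nz + n)" using W v by auto
      have "(?W *\<^sub>v v) \<bullet> (?F P j *\<^sub>v (?W *\<^sub>v v)) = ?q v j (P j)" if j: "j < l" for j
      proof -
        have "P j \<in> carrier_mat (nzs j + nws j) (nzs j + nws j)"
          using P[OF j] sym[OF j] by (auto simp: sym_mats_def)
        from quadratic_form_congruence[OF this O Wv]
        show ?thesis by (simp add: assoc_mult_mat_vec[OF O W v, symmetric] OW)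
      qed
      then show ?thesis
        using F by (subst quadratic_form_mat_sum[OF _ Wv]) (auto simp: sym_mats_def)
    qed
    then show ?thesis using psd_congruence_iff[OF mat_sum_in_sym_mats[OF F] W] by simp
  qed
  \<comment> \<open>Linearity in the multiplier, as needed to separate the blocks by
    scaling.\<close>
  have hom: "?q v j (c \<cdot>\<^sub>m P) = c * ?q v j P"
    if "j < l" "P \<in> Ps j" "v \<in> carrier_vec n" for v j c P
  proof -
    have P: "P \<in> carrier_mat (nzs j + nws j) (nzs j + nws j)"
      and Yv: "?Y j *\<^sub>v v \<in> carrier_vec (nzs j + nws j)"
      using sym[OF that(1)] that Y[of j] by (auto simp: sym_mats_def)
    have "P *\<^sub>v (?Y j *\<^sub>v v) \<in> carrier_vec (nzs j + nws j)" using P Yv by simp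
    moreover have "(c \<cdot>\<^sub>m P) *\<^sub>v w = c \<cdot>\<^sub>v (P *\<^sub>v w)" if "w \<in> carrier_vec (nzs j + nws j)" for w
      using P that by (intro eq_vecI) auto
    ultimately show ?thesis using Yv by simp
  qed
  have P_tilde: "P_tilde Bw nz l nws nzs Ps =
      {mat_sum (nz + n) l (?F P) | P. \<forall>j<l. P j \<in> Ps j}"
    unfolding P_tilde_def carrier_matD(1)[OF Bw] ..
  have "X \<in> quad_set n nz (P_tilde Bw nz l nws nzs Ps) \<longleftrightarrow>
      (\<forall>P. (\<forall>j<l. P j \<in> Ps j) \<longrightarrow> psd (?W\<^sup>T * mat_sum (nz + n) l (?F P) * ?W))"
    unfolding quad_set_def P_tilde using X by blast
  also have "\<dots> \<longleftrightarrow>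
      (\<forall>P. (\<forall>j<l. P j \<in> Ps j) \<longrightarrow> (\<forall>v\<in>carrier_vec n. 0 \<le> (\<Sum>j<l. ?q v j (P j))))"
    by (intro arg_cong[where f = All] ext imp_cong refl tilde) blast
  \<comment> \<open>The vector is quantified first, so that the separation of blocks can be applied
    to scalars at each fixed \<open>v\<close>.\<close>
  also have "\<dots> \<longleftrightarrow>
      (\<forall>v\<in>carrier_vec n. \<forall>P. (\<forall>j<l. P j \<in> Ps j) \<longrightarrow> 0 \<le> (\<Sum>j<l. ?q v j (P j)))"
    by blast
  also have "\<dots> \<longleftrightarrow> (\<forall>v\<in>carrier_vec n. \<forall>j<l. \<forall>P\<in>Ps j. 0 \<le> ?q v j P)"
  proof (intro ball_cong[OF refl] cone_forms_nonneg_sum_iff)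
    show "Ps j \<noteq> {}" if "j < l" for j using neg[OF that] by blast
    show "c \<cdot>\<^sub>m P \<in> Ps j" if "j < l" "P \<in> Ps j" "c > 0" for j P c
      using cone[OF that(1)] that by (simp add: convex_cone_of_sym_def)
  qed (rule hom)
  also have "\<dots> \<longleftrightarrow> (\<forall>j<l. \<forall>P\<in>Ps j. psd ((?Y j)\<^sup>T * P * ?Y j))"
  proof -
    have "psd ((?Y j)\<^sup>T * P * ?Y j) \<longleftrightarrow> (\<forall>v\<in>carrier_vec n. 0 \<le> ?q v j P)"
      if "j < l" "P \<in> Ps j" for j P
      by (rule psd_congruence_iff[OF subsetD[OF sym[OF that(1)] that(2)] Y])
    then show ?thesis by blast
  qed
  also have "\<dots> \<longleftrightarrow> (\<forall>j<l. \<exists>\<Delta>\<in>quad_set (nws j) (nzs j) (Ps j). X * ?L j = ?B j * \<Delta>)"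
  proof -
    have "(\<forall>P\<in>Ps j. psd ((?Y j)\<^sup>T * P * ?Y j)) \<longleftrightarrow>
        (\<exists>\<Delta>\<in>quad_set (nws j) (nzs j) (Ps j). X * ?L j = ?B j * \<Delta>)" if "j < l" for j
      by (rule psd_append_iff_factor[OF B rank[OF that] XL sym[OF that] neg[OF that]])
    then show ?thesis by blast
  qed
  finally show ?thesis .
qed

text \<open>The factors \<Delta>_j obtained for the separate blocks are assembled into one block
  diagonal \<Delta>; X and B_w \<Delta> have the same block columns B_j \<Delta>_j. Conversely, the
  blocks of \<Delta> are the required factors.\<close>

lemma quad_set_P_tilde_eq:
  assumes Bw: "Bw \<in> carrier_mat n nw"
    and nw: "(\<Sum>j<l. nws j) = nw" and nz: "(\<Sum>j<l. nzs j) = nz"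
    and rank: "\<And>j. j < l \<Longrightarrow> full_col_rank (Bw * id_block_col nw nws j)"
    and cone: "\<And>j. j < l \<Longrightarrow> convex_cone_of_sym (nzs j + nws j) (Ps j)"
    and neg: "\<And>j. j < l \<Longrightarrow> \<exists>P\<in>Ps j. neg_def (left_upper (nzs j) P)"
  shows "quad_set n nz (P_tilde Bw nz l nws nzs Ps) = (\<lambda>\<Delta>. Bw * \<Delta>) ` \<Delta>_prior l nws nzs Ps"
proof -
  have block: "Bw * diag_block_mat (map \<Delta>s [0..<l]) * id_block_col nz nzs j
      = Bw * id_block_col nw nws j * \<Delta>s j"
    if \<Delta>s: "\<And>j. j < l \<Longrightarrow> \<Delta>s j \<in> carrier_mat (nws j) (nzs j)" and j: "j < l" for \<Delta>s j
  proof -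
    have D: "diag_block_mat (map \<Delta>s [0..<l]) \<in> carrier_mat nw nz"
      using diag_block_mat_carrier[of l \<Delta>s nws nzs, OF \<Delta>s] nw nz by simp
    have "Bw * diag_block_mat (map \<Delta>s [0..<l]) * id_block_col nz nzs j
        = Bw * (diag_block_mat (map \<Delta>s [0..<l]) * id_block_col nz nzs j)"
      by (rule assoc_mult_mat[OF Bw D id_block_col_carrier])
    also have "\<dots> = Bw * (id_block_col nw nws j * \<Delta>s j)"
      using diag_block_mat_mult_id_block_col[of l \<Delta>s nws nzs, OF \<Delta>s nw nz j] by simp
    also have "\<dots> = Bw * id_block_col nw nws j * \<Delta>s j"
      by (rule assoc_mult_mat[OF Bw id_block_col_carrier[of nw nws j] \<Delta>s[OF j], symmetric])
    finally show ?thesis .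
  qed
  have dim: "Bw * diag_block_mat (map \<Delta>s [0..<l]) \<in> carrier_mat n nz"
    if \<Delta>s: "\<And>j. j < l \<Longrightarrow> \<Delta>s j \<in> carrier_mat (nws j) (nzs j)" for \<Delta>s
    using diag_block_mat_carrier[of l \<Delta>s nws nzs, OF \<Delta>s] nw nz Bw by simp
  note iff = quad_set_P_tilde_iff[OF Bw rank cone neg]
  show ?thesis
  proof (intro equalityI subsetI)
    fix X assume X': "X \<in> quad_set n nz (P_tilde Bw nz l nws nzs Ps)"
    then have X: "X \<in> carrier_mat n nz" by (simp add: quad_set_def)
    \<comment> \<open>A choice over the blocks turns the separate existence statements into one
      family.\<close>
    obtain \<Delta>s where \<Delta>s: "\<And>j. j < l \<Longrightarrow> \<Delta>s j \<in> quad_set (nws j) (nzs j) (Ps j)"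
      "\<And>j. j < l \<Longrightarrow> X * id_block_col nz nzs j = Bw * id_block_col nw nws j * \<Delta>s j"
      using iff[OF _ _ _ X] X' by metis
    then have c: "\<Delta>s j \<in> carrier_mat (nws j) (nzs j)" if "j < l" for j
      using that by (auto simp: quad_set_def)
    have "X = Bw * diag_block_mat (map \<Delta>s [0..<l])"
      using block[OF c] \<Delta>s(2) by (intro eq_mat_id_block_colI[OF X dim[OF c] nz]) auto
    then show "X \<in> (\<lambda>\<Delta>. Bw * \<Delta>) ` \<Delta>_prior l nws nzs Ps"
      using \<Delta>s(1) by (auto simp: \<Delta>_prior_def)
  next
    fix X assume "X \<in> (\<lambda>\<Delta>. Bw * \<Delta>) ` \<Delta>_prior l nws nzs Ps"
    then obtain \<Delta>s where X: "X = Bw * diag_block_mat (map \<Delta>s [0..<l])"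
      and \<Delta>s: "\<And>j. j < l \<Longrightarrow> \<Delta>s j \<in> quad_set (nws j) (nzs j) (Ps j)"
      by (auto simp: \<Delta>_prior_def)
    have c: "\<Delta>s j \<in> carrier_mat (nws j) (nzs j)" if "j < l" for j
      using \<Delta>s[OF that] by (auto simp: quad_set_def)
    show "X \<in> quad_set n nz (P_tilde Bw nz l nws nzs Ps)"
      using iff[OF _ _ _ dim[OF c]] block[OF c] \<Delta>s unfolding X by blast
  qed
qed

theorem lemma3:
  fixes A B Bd Bw Cz Dz X Xp U M Z \<Delta>tr Dtr :: "real mat"
    and x u d w z :: "nat \<Rightarrow> real vec"
    and n m nd nw nz N l :: nat
    and nws nzs :: "nat \<Rightarrow> nat"
    and Ps :: "nat \<Rightarrow> real mat set"
    and Pd \<Delta>_com \<Delta>_com_tilde :: "real mat set"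
  assumes system_dims:
      "A \<in> carrier_mat n n" "B \<in> carrier_mat n m" "Bd \<in> carrier_mat n nd"
      "Bw \<in> carrier_mat n nw" "Cz \<in> carrier_mat nz n" "Dz \<in> carrier_mat nz m"
    and Bd_rank: "full_col_rank Bd"
    and block_dims: "(\<Sum>j<l. nws j) = nw" "(\<Sum>j<l. nzs j) = nz"
    and Bj_rank: "\<And>j. j < l \<Longrightarrow> full_col_rank (Bw * id_block_col nw nws j)"
    and Ps_cone: "\<And>j. j < l \<Longrightarrow> convex_cone_of_sym (nzs j + nws j) (Ps j)"
    and Ps_lmi: "\<And>j. j < l \<Longrightarrow> lmi_representation (nzs j + nws j) (Ps j)"
    and Ps_neg: "\<And>j. j < l \<Longrightarrow> \<exists>P\<in>Ps j. neg_def (left_upper (nzs j) P)"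
    and Pd_cone: "convex_cone_of_sym (N + nd) Pd"
    and Pd_lmi: "lmi_representation (N + nd) Pd"
    and Pd_neg: "\<exists>P\<in>Pd. neg_def (left_upper N P)"
    and signal_dims:
      "\<And>k. k \<le> N \<Longrightarrow> x k \<in> carrier_vec n"
      "\<And>k. k < N \<Longrightarrow> u k \<in> carrier_vec m"
      "\<And>k. k < N \<Longrightarrow> d k \<in> carrier_vec nd"
    and \<Delta>tr: "\<Delta>tr \<in> \<Delta>_prior l nws nzs Ps"
    and Dtr: "Dtr = mat_of_cols nd (map d [0..<N])" "Dtr \<in> quad_set nd N Pd"
    and trajectory:
      "\<And>k. k < N \<Longrightarrow> x (Suc k) = A *\<^sub>v x k + B *\<^sub>v u k + Bd *\<^sub>v d k + Bw *\<^sub>v w k"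
      "\<And>k. k < N \<Longrightarrow> z k = Cz *\<^sub>v x k + Dz *\<^sub>v u k"
      "\<And>k. k < N \<Longrightarrow> w k = \<Delta>tr *\<^sub>v z k"
    and data:
      "X = mat_of_cols n (map x [0..<N])"
      "Xp = mat_of_cols n (map x [1..<Suc N])"
      "U = mat_of_cols m (map u [0..<N])"
      "M = Xp - A * X - B * U"
      "Z = Cz * X + Dz * U"
    and com: "\<Delta>_com = \<Delta>_prior l nws nzs Ps \<inter> \<Delta>_learnt M Z Bw Bd (quad_set nd N Pd)"
    and com_tilde: "\<Delta>_com_tilde =
      quad_set n nz (P_tilde Bw nz l nws nzs Ps) \<inter> quad_set n nz (P0_tilde M Z Bd Pd)"
  shows "\<Delta>_com_tilde = {Bw * \<Delta> | \<Delta>. \<Delta> \<in> \<Delta>_com}"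
proof -
  have M: "M \<in> carrier_mat n N" and Z: "Z \<in> carrier_mat nz N"
  proof -
    have X: "X \<in> carrier_mat n N" and Xp: "Xp \<in> carrier_mat n N" and U: "U \<in> carrier_mat m N"
      unfolding data(1-3) by (auto intro!: carrier_matI simp del: upt_Suc)
    have "A * X \<in> carrier_mat n N" "B * U \<in> carrier_mat n N"
      "Cz * X \<in> carrier_mat nz N" "Dz * U \<in> carrier_mat nz N"
      using system_dims X U by auto
    then show "M \<in> carrier_mat n N" "Z \<in> carrier_mat nz N"
      unfolding data(4,5) using Xp by (auto intro!: minus_carrier_mat add_carrier_mat)
  qed
  have Pd: "Pd \<subseteq> sym_mats (N + nd)" using Pd_cone by (simp add: convex_cone_of_sym_def)
  \<comment> \<open>\<open>\<Delta>_learnt\<close> also fixes the dimensions of its members, which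
    prior uncertainties have by their block sizes.\<close>
  have prior: "\<Delta> \<in> carrier_mat nw nz" if "\<Delta> \<in> \<Delta>_prior l nws nzs Ps" for \<Delta>
  proof -
    obtain \<Delta>s where \<Delta>s: "\<Delta> = diag_block_mat (map \<Delta>s [0..<l])"
      "\<And>j. j < l \<Longrightarrow> \<Delta>s j \<in> carrier_mat (nws j) (nzs j)"
      using \<open>\<Delta> \<in> \<Delta>_prior l nws nzs Ps\<close> by (auto simp: \<Delta>_prior_def quad_set_def)
    show ?thesis
      using diag_block_mat_carrier[of l \<Delta>s nws nzs, OF \<Delta>s(2)] block_dims \<Delta>s(1) by simp
  qed
  \<comment> \<open>Apart from dimensions, the data constrain \<Delta> only through
    \<open>Bw * \<Delta>\<close>. Hence the image under \<open>Bw\<close> respects the intersection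
    of the prior and learnt sets, although \<open>Bw\<close> may fail to be injective.\<close>
  have learnt: "Bw * \<Delta> \<in> quad_set n nz (P0_tilde M Z Bd Pd) \<longleftrightarrow>
      \<Delta> \<in> \<Delta>_learnt M Z Bw Bd (quad_set nd N Pd)" if "\<Delta> \<in> \<Delta>_prior l nws nzs Ps" for \<Delta>
    using quad_set_P0_tilde_iff[OF M Z system_dims(3) Bd_rank Pd Pd_neg, of "Bw * \<Delta>"]
      prior[OF that] system_dims(4) carrier_matD[OF Z] by (simp add: \<Delta>_learnt_def)
  show ?thesis
    using quad_set_P_tilde_eq[where Ps = Ps, OF system_dims(4) block_dims Bj_rank Ps_cone Ps_neg] learnt
    unfolding com com_tilde by auto
qed

end
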